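(* Let $f$ be a real entire function of genus $p$ with only real zeros $\{\lambda_k\}$ (counted with multiplicity), and let $m=\lfloor p/2\rfloor$. For $a\in\mathbb R$ we have $$(-1)^m\partial_x^{m+1}\log|f(a+i\sqrt x)|=\frac{m!}{2}\int_0^\infty\frac{d\mu_a(t)}{(t+x)^{m+1}},\qquad x>0,$$ where $\mu_a=\sum_{k\ge1}\epsilon_{(a-\lambda_k)^2}$.
   Context: A real entire function is an entire function (not identically zero) that is real on the real axis. $\epsilon_c$ denotes the unit point mass at $c$; sums over $k$ run over all zeros. $\partial_x$ is differentiation with respect to $x$. *)

theory Defs
  imports "HOL-Complex_Analysis.Complex_Analysis"
begin

definition real_entire :: "(complex \<Rightarrow> complex) \<Rightarrow> bool" where
  "real_entire f \<longleftrightarrow> f holomorphic_on UNIV \<and> (\<exists>z. f z \<noteq> 0) \<and> (\<forall>x::real. f (of_real x) \<in> \<real>)"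

text \<open>The multiplicity of a point as a zero of an entire function \<open>f\<close> (not identically zero);
  it is 0 where \<open>f\<close> does not vanish.\<close>

definition zero_mult :: "(complex \<Rightarrow> complex) \<Rightarrow> complex \<Rightarrow> nat" where
  "zero_mult f z = (if f z = 0 then nat (zorder f z) else 0)"

text \<open>The sequence \<open>b\<close> lists the zeros of \<open>f\<close> other than the origin, each as often as its
  multiplicity. Since there may be only finitely many, terms \<open>b n = 0\<close> are allowed as
  padding: as \<open>z / 0 = 0\<close>, they contribute nothing to the sum and the product in
  \<open>has_genus\<close> below.\<close>

definition lists_nonzero_zeros :: "(complex \<Rightarrow> complex) \<Rightarrow> (nat \<Rightarrow> complex) \<Rightarrow> bool" where
  "lists_nonzero_zeros f b \<longleftrightarrow>
     (\<forall>z. z \<noteq> 0 \<longrightarrow> finite {n. b n = z} \<and> card {n. b n = z} = zero_mult f z)"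

text \<open>The genus of an entire function is the maximum of \<open>degree g\<close> and \<open>q\<close> in the Hadamard
  representation $f(z) = z^{r} e^{g(z)} \prod_n E_q(z/b_n)$, where \<open>g\<close> is a polynomial and \<open>q\<close>
  is the least natural number such that $\sum_n |b_n|^{-(q+1)}$ converges (so \<open>q = 0\<close>
  if there are finitely many zeros). Only functions that have such a representation have a
  (finite) genus.\<close>

definition has_genus :: "(complex \<Rightarrow> complex) \<Rightarrow> nat \<Rightarrow> bool" where
  "has_genus f p \<longleftrightarrow>
     (\<exists>(b :: nat \<Rightarrow> complex) (g :: complex poly) (q :: nat).
        lists_nonzero_zeros f b \<and>
        summable (\<lambda>n. 1 / cmod (b n) ^ (q + 1)) \<and>
        (\<forall>q'<q. \<not> summable (\<lambda>n. 1 / cmod (b n) ^ (q' + 1))) \<and>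
        (\<forall>z. f z = z ^ zero_mult f 0 * exp (poly g z) *
                   (\<Prod>n. weierstrass_factor q (z / b n))) \<and>
        p = max (degree g) q)"

text \<open>The real zeros of \<open>f\<close> counted with multiplicity: the zero \<open>l\<close> is represented by the
  indices \<open>(l, 0), \<dots>, (l, zero_mult f l - 1)\<close>.\<close>

definition real_zeros :: "(complex \<Rightarrow> complex) \<Rightarrow> (real \<times> nat) set" where
  "real_zeros f = {(l, j). j < zero_mult f (of_real l)}"

text \<open>The sum of the unit point masses at \<open>c i\<close> over \<open>i \<in> I\<close> is the image under \<open>c\<close> of the
  counting measure on \<open>I\<close>; see \<open>emeasure_sum_point_masses\<close>.\<close>

definition sum_point_masses :: "'i set \<Rightarrow> ('i \<Rightarrow> real) \<Rightarrow> real measure" where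
  "sum_point_masses I c = distr (count_space I) borel c"

lemma emeasure_sum_point_masses:
  assumes "A \<in> sets borel"
  shows "emeasure (sum_point_masses I c) A = (\<integral>\<^sup>+ i. indicator A (c i) \<partial>count_space I)"
proof -
  have "emeasure (sum_point_masses I c) A = (\<integral>\<^sup>+ t. indicator A t \<partial>sum_point_masses I c)"
    using assms by (simp add: sum_point_masses_def)
  also have "\<dots> = (\<integral>\<^sup>+ i. indicator A (c i) \<partial>count_space I)"
    unfolding sum_point_masses_def using assms by (subst nn_integral_distr) auto
  finally show ?thesis .
qed

definition zero_measure :: "(complex \<Rightarrow> complex) \<Rightarrow> real \<Rightarrow> real measure" where
  "zero_measure f a = sum_point_masses (real_zeros f) (\<lambda>(l, j). (a - l)\<^sup>2)"

end

theory Submission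
  imports Defs
begin

text \<open>
  Put $V(w) = f(a + i\sqrt{w})\, f(a - i\sqrt{w})$, a holomorphic function on the right half-plane.
  As \<open>f\<close> is real on the real axis and has no zeros off it, $V(x) = |f(a + i\sqrt{x})|^2 > 0$ for
  $x > 0$, so that $\partial_x^{m+1} \log|f(a + i\sqrt{x})|$ is half the \<open>m\<close>-th derivative of $V'/V$ at \<open>x\<close>.
  This makes it possible to argue with complex derivatives only
  (\<open>higher_deriv_ln_cmod_on_vertical_line\<close>).

  If $P(z) = C \prod_k (z - c_k)\, e^{G(z)}$ is a finite product with real $c_k$, the corresponding
  function is $C^2 \prod_k ((a - c_k)^2 + w)\, e^{Q(w)}$, where $Q(s^2) = G(a + is) + G(a - is)$.
  Only the even powers of \<open>s\<close> survive in this sum, hence $\deg Q \le \lfloor \deg G/2 \rfloor$,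
  which is at most $m = \lfloor p/2 \rfloor$ if $\deg G \le p$. The polynomial part $Q'$ of the
  logarithmic derivative has degree less than \<open>m\<close> or vanishes, so that \<open>m\<close> differentiations
  kill it and leave $(-1)^m m! \sum_k ((a - c_k)^2 + x)^{-(m+1)}$
  (\<open>higher_deriv_logderiv_line_square\<close>).

  The partial products of the Hadamard representation of \<open>f\<close> have this form, because the exponents
  in the factors $E_q$ have degree at most $q \le p$, and they converge to \<open>f\<close> uniformly on
  discs (\<open>finite_genus_real_zeros_approximation\<close>). Since all derivatives of a locally uniform limit
  of holomorphic functions are limits of derivatives, the finite sums converge to
  $(-1)^m (m!)^{-1}$ times the \<open>m\<close>-th derivative of $V'/V$
  (\<open>sums_higher_deriv_logderiv_line_square\<close>). Their terms are positive, so
  convergence is already integrability with respect to the zero measure.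
\<close>

section \<open>Higher derivatives\<close>

text \<open>A sequence in which each function is the derivative of its predecessor on an open set lists the
  iterated derivatives. Stated for both real and complex functions: it serves to
  differentiate sums of reciprocals in the complex plane as well as real parts on the positive axis.\<close>

lemma higher_deriv_eqI:
  fixes D :: "nat \<Rightarrow> 'a::real_normed_field \<Rightarrow> 'a"
  assumes "open S" and f: "\<And>z. z \<in> S \<Longrightarrow> f z = D 0 z"
    and D: "\<And>j z. z \<in> S \<Longrightarrow> (D j has_field_derivative D (Suc j) z) (at z)"
    and "z \<in> S"
  shows "(deriv ^^ n) f z = D n z"
  using \<open>z \<in> S\<close>
proof (induction n arbitrary: z)
  case 0
  then show ?case by (simp add: f)
next
  case (Suc n)
  have "eventually (\<lambda>y. (deriv ^^ n) f y = D n y) (nhds z)"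
    using eventually_nhds_in_open[OF \<open>open S\<close> Suc.prems] by eventually_elim (rule Suc.IH)
  then have "deriv ((deriv ^^ n) f) z = deriv (D n) z"
    by (rule deriv_cong_ev) simp
  also have "\<dots> = D (Suc n) z"
    by (rule DERIV_imp_deriv) (rule D[OF Suc.prems])
  finally show ?case by simp
qed

lemma higher_deriv_has_field_derivative:
  fixes D :: "nat \<Rightarrow> 'a::real_normed_field \<Rightarrow> 'a"
  assumes "open S" and f: "\<And>z. z \<in> S \<Longrightarrow> f z = D 0 z"
    and D: "\<And>j z. z \<in> S \<Longrightarrow> (D j has_field_derivative D (Suc j) z) (at z)"
    and "z \<in> S"
  shows "((deriv ^^ n) f has_field_derivative D (Suc n) z) (at z)"
proof -
  have "eventually (\<lambda>y. (deriv ^^ n) f y = D n y) (nhds z)"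
    using eventually_nhds_in_open[OF \<open>open S\<close> \<open>z \<in> S\<close>]
    by eventually_elim (rule higher_deriv_eqI[OF \<open>open S\<close> f D])
  then show ?thesis
    using D[OF \<open>z \<in> S\<close>, of n] by (subst DERIV_cong_ev[OF refl _ refl])
qed

lemma holomorphic_logderiv:
  assumes "open S" "h holomorphic_on S" "\<And>w. w \<in> S \<Longrightarrow> h w \<noteq> 0"
  shows "(\<lambda>w. deriv h w / h w) holomorphic_on S"
  using assms by (intro holomorphic_intros) auto

text \<open>Leibniz' rule for $h' = (h'/h) \cdot h$, solved for the highest derivative of $h'/h$. It expresses
  the derivatives of $h'/h$ at a point through those of \<open>h\<close> by operations that are continuous
  where \<open>h\<close> does not vanish.\<close>

lemma higher_deriv_logderiv_rec:
  assumes "open S" and h: "h holomorphic_on S" and nz: "\<And>w. w \<in> S \<Longrightarrow> h w \<noteq> 0" and "z \<in> S"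
  shows "(deriv ^^ j) (\<lambda>w. deriv h w / h w) z =
           ((deriv ^^ Suc j) h z -
             (\<Sum>i<j. of_nat (j choose i) * (deriv ^^ i) (\<lambda>w. deriv h w / h w) z
                       * (deriv ^^ (j - i)) h z)) / h z"
proof -
  let ?l = "\<lambda>w. deriv h w / h w"
  have "eventually (\<lambda>w. deriv h w = ?l w * h w) (nhds z)"
    using eventually_nhds_in_open[OF \<open>open S\<close> \<open>z \<in> S\<close>] by eventually_elim (simp add: nz)
  then have "(deriv ^^ j) (deriv h) z = (deriv ^^ j) (\<lambda>w. ?l w * h w) z"
    by (rule higher_deriv_cong_ev) simp
  also have "\<dots> = (\<Sum>i = 0..j. of_nat (j choose i) * (deriv ^^ i) ?l z * (deriv ^^ (j-i)) h z)"
    by (rule higher_deriv_mult[OF holomorphic_logderiv[OF assms(1-3)] h \<open>open S\<close> \<open>z \<in> S\<close>])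
  also have "{0..j} = insert j {..<j}"
    by auto
  finally show ?thesis
    using nz[OF \<open>z \<in> S\<close>] by (simp add: funpow_Suc_right field_simps del: funpow.simps)
qed

text \<open>By the recursion, convergence of the derivatives of $H_n$ at the single point \<open>z\<close> carries over to
  the derivatives of $H_n'/H_n$, by induction on their order.\<close>

lemma higher_deriv_logderiv_tendsto:
  assumes "open S" "z \<in> S" and lim: "uniform_limit S H G sequentially"
    and H: "\<And>n. H n holomorphic_on S" "\<And>n w. w \<in> S \<Longrightarrow> H n w \<noteq> 0"
    and G: "G holomorphic_on S" "\<And>w. w \<in> S \<Longrightarrow> G w \<noteq> 0"
  shows "(\<lambda>n. (deriv ^^ j) (\<lambda>w. deriv (H n) w / H n w) z)
           \<longlonglongrightarrow> (deriv ^^ j) (\<lambda>w. deriv G w / G w) z"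
proof (induction j rule: less_induct)
  case (less j)
  have lim_deriv: "(\<lambda>n. (deriv ^^ i) (H n) z) \<longlonglongrightarrow> (deriv ^^ i) G z" for i
    by (rule higher_deriv_complex_uniform_limit[OF lim]) (use H assms in auto)
  have "(\<lambda>n. ((deriv ^^ Suc j) (H n) z -
             (\<Sum>i<j. of_nat (j choose i) * (deriv ^^ i) (\<lambda>w. deriv (H n) w / H n w) z
                       * (deriv ^^ (j - i)) (H n) z)) / H n z)
        \<longlonglongrightarrow> ((deriv ^^ Suc j) G z -
             (\<Sum>i<j. of_nat (j choose i) * (deriv ^^ i) (\<lambda>w. deriv G w / G w) z
                       * (deriv ^^ (j - i)) G z)) / G z"
    using lim_deriv[of 0] G(2)[OF \<open>z \<in> S\<close>]
    by (intro tendsto_intros lim_deriv less.IH) auto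
  then show ?case
    by (simp only: higher_deriv_logderiv_rec[OF \<open>open S\<close> G \<open>z \<in> S\<close>, where j = j, symmetric]
      higher_deriv_logderiv_rec[OF \<open>open S\<close> H \<open>z \<in> S\<close>, where j = j, symmetric])
qed

lemma higher_deriv_sum_inverse_plus_poly:
  fixes d :: "'i \<Rightarrow> complex"
  assumes "finite A" "open S" "z \<in> S" and nz: "\<And>k w. k \<in> A \<Longrightarrow> w \<in> S \<Longrightarrow> d k + w \<noteq> 0"
    and h: "\<And>w. w \<in> S \<Longrightarrow> h w = (\<Sum>k\<in>A. 1 / (d k + w)) + poly Q w"
  shows "(deriv ^^ n) h z =
           (-1) ^ n * fact n * (\<Sum>k\<in>A. 1 / (d k + z) ^ Suc n) + poly ((pderiv ^^ n) Q) z"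
proof -
  define D where "D = (\<lambda>n z. (\<Sum>k\<in>A. (-1) ^ n * fact n / (d k + z) ^ Suc n)
      + poly ((pderiv ^^ n) Q) z)"
  have summand: "((\<lambda>w. (-1) ^ j * fact j / (d k + w) ^ Suc j) has_field_derivative
        (-1) ^ Suc j * fact (Suc j) / (d k + w) ^ Suc (Suc j)) (at w)" if "k \<in> A" "w \<in> S" for j k w
  proof -
    have "((\<lambda>w. (-1) ^ j * fact j / (d k + w) ^ Suc j) has_field_derivative
        (- ((-1) ^ j * fact j * (of_nat (Suc j) * (d k + w) ^ j))
           / ((d k + w) ^ Suc j * (d k + w) ^ Suc j))) (at w)"
      using nz[OF that] by (auto intro!: derivative_eq_intros simp del: power_Suc)
    also have "- ((-1) ^ j * fact j * (of_nat (Suc j) * (d k + w) ^ j))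
           / ((d k + w) ^ Suc j * (d k + w) ^ Suc j) =
        (-1) ^ Suc j * fact (Suc j) / (d k + w) ^ Suc (Suc j)"
      using nz[OF that] by (simp add: divide_simps)
    finally show ?thesis .
  qed
  have "(deriv ^^ n) h z = D n z"
  proof (rule higher_deriv_eqI[OF \<open>open S\<close> _ _ \<open>z \<in> S\<close>])
    show "h w = D 0 w" if "w \<in> S" for w
      using h[OF that] by (simp add: D_def)
    show "(D j has_field_derivative D (Suc j) w) (at w)" if "w \<in> S" for j w
      unfolding D_def using that
      by (intro DERIV_add DERIV_sum summand) (auto intro: poly_DERIV)
  qed
  then show ?thesis
    by (simp add: D_def sum_distrib_left)
qed

section \<open>Even parts of polynomials\<close>

text \<open>Two coefficients are split off at a time: for $h(s) = c + d s + s^2 h_2(s)$ the odd term \<open>d s\<close>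
  cancels.\<close>

lemma even_part_poly:
  fixes h :: "'a::{idom, ring_char_0} poly"
  shows "\<exists>Q. degree Q \<le> degree h div 2 \<and> (\<forall>s. poly h s + poly h (- s) = poly Q (s\<^sup>2))"
proof (induction "degree h" arbitrary: h rule: less_induct)
  case less
  show ?case
  proof (cases "degree h < 2")
    case True
    obtain c h1 where h: "h = pCons c h1" by (cases h)
    with True have "degree h1 = 0" by (auto split: if_splits)
    then obtain d where "h1 = [:d:]" by (rule degree_eq_zeroE)
    with h show ?thesis by (intro exI[of _ "[:2 * c:]"]) simp
  next
    case False
    obtain c h1 where h: "h = pCons c h1" by (cases h)
    obtain d h2 where h1: "h1 = pCons d h2" by (cases h1)
    have deg: "degree h = Suc (Suc (degree h2))"
      using False by (auto simp: h h1 split: if_splits)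
    then obtain Q where Q: "degree Q \<le> degree h2 div 2" "\<And>s. poly h2 s + poly h2 (- s) = poly Q (s\<^sup>2)"
      using less[of h2] by auto
    have "poly h s + poly h (- s) = poly (pCons (2 * c) Q) (s\<^sup>2)" for s
      by (simp add: h h1 Q(2)[symmetric]) (simp add: algebra_simps power2_eq_square)
    moreover have "degree (pCons (2 * c) Q) \<le> degree h div 2"
      using Q(1) deg by (auto intro: order.trans[OF degree_pCons_le])
    ultimately show ?thesis by blast
  qed
qed

text \<open>The bound on the degree is the source of $\lfloor p/2 \rfloor$ in the theorem.\<close>

lemma poly_on_vertical_line:
  fixes g :: "complex poly"
  obtains Q where "degree Q \<le> degree g div 2"
    and "\<And>s. poly g (a + \<i> * s) + poly g (a - \<i> * s) = poly Q (s\<^sup>2)"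
proof -
  have "degree (pcompose g [:a, \<i>:]) = degree g"
    by (simp add: degree_pcompose)
  then show ?thesis
    using even_part_poly[of "pcompose g [:a, \<i>:]"] that
    by (force simp: poly_pcompose algebra_simps)
qed


section \<open>The restriction of an entire function to a vertical line\<close>

text \<open>For a real entire \<open>f\<close>, real \<open>a\<close> and $x > 0$ the value at \<open>x\<close> is $|f(a + i\sqrt{x})|^2$; unlike the
  modulus, this product is holomorphic in \<open>w\<close>.\<close>

definition line_square :: "(complex \<Rightarrow> complex) \<Rightarrow> complex \<Rightarrow> complex \<Rightarrow> complex" where
  "line_square f a w = f (a + \<i> * csqrt w) * f (a - \<i> * csqrt w)"

lemma right_half_plane_not_nonpos_Reals: "0 < Re w \<Longrightarrow> w \<notin> \<real>\<^sub>\<le>\<^sub>0"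
  by (auto simp: complex_nonpos_Reals_iff)

lemma Re_csqrt_pos: "0 < Re w \<Longrightarrow> 0 < Re (csqrt w)"
  using csqrt_principal[of w] abs_Re_le_cmod[of w] by (auto intro!: add_nonneg_pos)

lemma open_right_half_plane: "open {w. 0 < Re w}"
  by (rule open_halfspace_Re_gt)

lemma holomorphic_line_square:
  assumes "f holomorphic_on UNIV"
  shows "line_square f a holomorphic_on {w. 0 < Re w}"
proof -
  have c: "csqrt holomorphic_on {w. 0 < Re w}"
    by (rule holomorphic_on_subset[of _ "- \<real>\<^sub>\<le>\<^sub>0"])
       (auto intro!: holomorphic_intros dest: right_half_plane_not_nonpos_Reals)
  have "(f \<circ> (\<lambda>w. a + \<i> * csqrt w)) holomorphic_on {w. 0 < Re w}"
       "(f \<circ> (\<lambda>w. a - \<i> * csqrt w)) holomorphic_on {w. 0 < Re w}"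
    by (intro holomorphic_on_compose_gen[OF _ assms] holomorphic_intros c; simp)+
  then show ?thesis
    unfolding line_square_def[abs_def] by (auto intro: holomorphic_on_mult simp: o_def)
qed

text \<open>The points $a \pm i\sqrt{w}$ avoid the real axis because $\mathrm{Re}\,\sqrt{w} > 0$.\<close>

lemma line_square_nonzero:
  assumes "\<And>z. f z = 0 \<Longrightarrow> z \<in> \<real>" "a \<in> \<real>" "0 < Re w"
  shows "line_square f a w \<noteq> 0"
proof -
  have "a + \<i> * csqrt w \<notin> \<real>" "a - \<i> * csqrt w \<notin> \<real>"
    using assms(2) Re_csqrt_pos[OF assms(3)]
    by (auto simp: complex_is_Real_iff simp del: csqrt.sel)
  then show ?thesis
    using assms(1) by (auto simp: line_square_def)
qed

lemma uniform_limit_line_square: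
  assumes lim: "\<And>R. 0 < R \<Longrightarrow> uniform_limit (cball 0 R) P f sequentially"
    and f: "f holomorphic_on UNIV" and "bounded B"
  shows "uniform_limit B (\<lambda>n. line_square (P n) a) (line_square f a) sequentially"
proof -
  obtain b where b: "\<And>w. w \<in> B \<Longrightarrow> norm w \<le> b"
    using \<open>bounded B\<close> by (auto simp: bounded_iff)
  define R where "R = norm a + sqrt (max b 0) + 1"
  have "R > 0"
    by (auto simp: R_def intro!: add_nonneg_pos)
  have csqrt_le: "norm (csqrt w) \<le> sqrt (max b 0)" if "w \<in> B" for w
    using b[OF that] by simp
  have "norm (a + \<i> * csqrt w) \<le> R" "norm (a - \<i> * csqrt w) \<le> R" if "w \<in> B" for w
    using csqrt_le[OF that] norm_triangle_ineq[of a "\<i> * csqrt w"]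
      norm_triangle_ineq4[of a "\<i> * csqrt w"] by (simp_all add: R_def norm_mult del: norm_csqrt)
  then have maps: "(\<lambda>w. a + \<i> * csqrt w) \<in> B \<rightarrow> cball 0 R" "(\<lambda>w. a - \<i> * csqrt w) \<in> B \<rightarrow> cball 0 R"
    by auto
  have "bounded (f ` cball 0 R)"
    by (intro compact_imp_bounded compact_continuous_image holomorphic_on_imp_continuous_on
        holomorphic_on_subset[OF f]) auto
  then have bdd: "bounded ((\<lambda>w. f (a + \<i> * csqrt w)) ` B)" "bounded ((\<lambda>w. f (a - \<i> * csqrt w)) ` B)"
    using maps by (auto elim!: bounded_subset)
  show ?thesis
    unfolding line_square_def
    by (intro uniform_lim_mult bdd uniform_limit_compose'[OF lim[OF \<open>R > 0\<close>]] maps)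
qed

text \<open>The two linear factors that belong to $c_k$ multiply to $(a - c_k)^2 + w$, which no longer
  contains the square root.\<close>

lemma line_square_poly_exp:
  fixes a C :: complex and c :: "'i \<Rightarrow> complex"
  assumes P: "\<And>z. P z = C * (\<Prod>k\<in>A. z - c k) * exp (poly G z)"
  obtains Q where "degree Q \<le> degree G div 2"
    "\<And>w. line_square P a w = C\<^sup>2 * (\<Prod>k\<in>A. (a - c k)\<^sup>2 + w) * exp (poly Q w)"
proof -
  obtain Q where Q: "degree Q \<le> degree G div 2"
    "\<And>s. poly G (a + \<i> * s) + poly G (a - \<i> * s) = poly Q (s\<^sup>2)"
    using poly_on_vertical_line by blast
  have "line_square P a w = C\<^sup>2 * (\<Prod>k\<in>A. (a - c k)\<^sup>2 + w) * exp (poly Q w)" for w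
  proof -
    have "(a + \<i> * csqrt w - c k) * (a - \<i> * csqrt w - c k) = (a - c k)\<^sup>2 + (csqrt w)\<^sup>2" for k
      by (simp add: algebra_simps power2_eq_square)
    then have "(\<Prod>k\<in>A. (a - c k)\<^sup>2 + w) =
        (\<Prod>k\<in>A. a + \<i> * csqrt w - c k) * (\<Prod>k\<in>A. a - \<i> * csqrt w - c k)"
      by (simp add: prod.distrib[symmetric])
    moreover have "exp (poly Q w) = exp (poly G (a + \<i> * csqrt w)) * exp (poly G (a - \<i> * csqrt w))"
      using Q(2)[of "csqrt w"] by (simp add: exp_add[symmetric])
    ultimately show ?thesis
      by (simp add: line_square_def P power2_eq_square)
  qed
  with Q(1) show thesis by (rule that)
qed

text \<open>The logarithmic derivative is $\sum_k 1/((a - c_k)^2 + w) + Q'(w)$, and \<open>m\<close> further derivatives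
  annihilate $Q'$ since $\deg Q \le m$.\<close>

lemma higher_deriv_logderiv_line_square:
  fixes a x :: real and c :: "'i \<Rightarrow> real"
  assumes P: "\<And>z. P z = C * (\<Prod>k\<in>A. z - of_real (c k)) * exp (poly G z)"
    and "finite A" "C \<noteq> 0" and m: "degree G div 2 \<le> m" and "0 < x"
  shows "(deriv ^^ m) (\<lambda>w. deriv (line_square P a) w / line_square P a w) (of_real x) =
           of_real ((-1) ^ m * fact m * (\<Sum>k\<in>A. 1 / ((a - c k)\<^sup>2 + x) ^ (m + 1)))"
proof -
  obtain Q where Q: "degree Q \<le> degree G div 2"
    "\<And>w. line_square P a w = C\<^sup>2 * (\<Prod>k\<in>A. (of_real a - of_real (c k))\<^sup>2 + w) * exp (poly Q w)"
    using line_square_poly_exp[OF P] by blast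
  define d where "d = (\<lambda>k. complex_of_real ((a - c k)\<^sup>2))"
  have V: "line_square P a = (\<lambda>w. C\<^sup>2 * (\<Prod>k\<in>A. d k + w) * exp (poly Q w))"
    by (rule ext) (simp add: Q(2) d_def)
  have nz: "d k + w \<noteq> 0" if "0 < Re w" for k w
  proof -
    have "0 < Re (d k + w)"
      using that by (simp add: d_def add_nonneg_pos)
    then show ?thesis by force
  qed
  have logderiv: "deriv (line_square P a) w / line_square P a w =
      (\<Sum>k\<in>A. 1 / (d k + w)) + poly (pderiv Q) w" if "0 < Re w" for w
  proof -
    note [derivative_intros] = has_field_derivative_prod' poly_DERIV
    have "deriv (line_square P a) w =
        line_square P a w * ((\<Sum>k\<in>A. 1 / (d k + w)) + poly (pderiv Q) w)"
      unfolding V using nz[OF that]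
      by (intro DERIV_imp_deriv) (auto intro!: derivative_eq_intros simp: algebra_simps)
    moreover have "line_square P a w \<noteq> 0"
      using nz[OF that] \<open>C \<noteq> 0\<close> \<open>finite A\<close> by (simp add: V)
    ultimately show ?thesis by simp
  qed
  have "(pderiv ^^ Suc m) Q = 0"
    using Q(1) m by (intro poly_eqI) (simp add: coeff_higher_pderiv coeff_eq_0 del: funpow.simps)
  then have "(pderiv ^^ m) (pderiv Q) = 0"
    by (simp add: funpow_Suc_right del: funpow.simps)
  then have "(deriv ^^ m) (\<lambda>w. deriv (line_square P a) w / line_square P a w) (of_real x) =
           (-1) ^ m * fact m * (\<Sum>k\<in>A. 1 / (d k + of_real x) ^ Suc m)"
    using higher_deriv_sum_inverse_plus_poly[OF \<open>finite A\<close> open_right_half_plane, of "of_real x" d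
        "\<lambda>w. deriv (line_square P a) w / line_square P a w" "pderiv Q" m] nz logderiv \<open>0 < x\<close>
    by simp
  then show ?thesis
    by (simp add: d_def)
qed

text \<open>Here \<open>J\<close> and \<open>c\<close> enumerate the zeros, and \<open>P N\<close> is an approximation of \<open>f\<close> with zeros \<open>c k\<close>,
  \<open>k < N + r\<close>; the shift \<open>r\<close> leaves room for the zero at the origin, which every partial product
  of the Hadamard representation contains with its full multiplicity.\<close>

lemma sums_higher_deriv_logderiv_line_square:
  fixes a x :: real and c :: "nat \<Rightarrow> real"
  assumes lim: "\<And>R. 0 < R \<Longrightarrow> uniform_limit (cball 0 R) P f sequentially"
    and f: "f holomorphic_on UNIV" "\<And>z. f z = 0 \<Longrightarrow> z \<in> \<real>"
    and P: "\<And>N. \<exists>C G. C \<noteq> 0 \<and> degree G div 2 \<le> m \<and>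
      (\<forall>z. P N z = C * (\<Prod>k\<in>{k\<in>J. k < N + r}. z - of_real (c k)) * exp (poly G z))"
    and "0 < x"
  shows "(\<lambda>k. if k \<in> J then 1 / ((a - c k)\<^sup>2 + x) ^ (m + 1) else 0) sums
    ((-1) ^ m / fact m *
      Re ((deriv ^^ m) (\<lambda>w. deriv (line_square f a) w / line_square f a w) (of_real x)))"
proof -
  define l where "l = (\<lambda>f w. deriv (line_square f a) w / line_square f a w)"
  \<comment> \<open>The largest disc about \<open>x\<close> in the half-plane; being bounded, it is a domain of uniform
    convergence.\<close>
  let ?S = "ball (of_real x) x :: complex set"
  have sub: "?S \<subseteq> {w. 0 < Re w}"
  proof
    fix w :: complex assume "w \<in> ?S"
    then have "\<bar>Re w - x\<bar> < x"
      using abs_Re_le_cmod[of "w - of_real x"] by (simp add: dist_norm norm_minus_commute)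
    then show "w \<in> {w. 0 < Re w}" by auto
  qed
  let ?s = "\<lambda>N. \<Sum>k\<in>{k\<in>J. k < N + r}. 1 / ((a - c k)\<^sup>2 + x) ^ (m + 1)"
  have P_holo: "P N holomorphic_on UNIV" and P_real: "\<And>z. P N z = 0 \<Longrightarrow> z \<in> \<real>"
    and P_deriv: "(deriv ^^ m) (l (P N)) (of_real x) = of_real ((-1) ^ m * fact m * ?s N)" for N
  proof -
    obtain C G where CG: "C \<noteq> 0" "degree G div 2 \<le> m"
      "\<And>z. P N z = C * (\<Prod>k\<in>{k\<in>J. k < N + r}. z - of_real (c k)) * exp (poly G z)"
      using P[of N] by blast
    have "P N = (\<lambda>z. C * (\<Prod>k\<in>{k\<in>J. k < N + r}. z - of_real (c k)) * exp (poly G z))"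
      by (rule ext) (rule CG)
    then show "P N holomorphic_on UNIV"
      by (auto intro!: holomorphic_intros)
    show "z \<in> \<real>" if "P N z = 0" for z
      using that CG by auto
    show "(deriv ^^ m) (l (P N)) (of_real x) = of_real ((-1) ^ m * fact m * ?s N)"
      unfolding l_def by (rule higher_deriv_logderiv_line_square[OF CG(3) _ CG(1,2) \<open>0 < x\<close>]) simp
  qed
  have "(\<lambda>N. (deriv ^^ m) (l (P N)) (of_real x)) \<longlonglongrightarrow> (deriv ^^ m) (l f) (of_real x)"
    unfolding l_def
  proof (rule higher_deriv_logderiv_tendsto)
    show "uniform_limit ?S (\<lambda>n. line_square (P n) a) (line_square f a) sequentially"
      by (rule uniform_limit_line_square[OF lim f(1)]) auto
    show "line_square (P n) a holomorphic_on ?S" for n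
      by (rule holomorphic_on_subset[OF holomorphic_line_square[OF P_holo] sub])
    show "line_square f a holomorphic_on ?S"
      by (rule holomorphic_on_subset[OF holomorphic_line_square[OF f(1)] sub])
    show "line_square (P n) a w \<noteq> 0" "line_square f a w \<noteq> 0" if "w \<in> ?S" for n w
      using line_square_nonzero[OF P_real] line_square_nonzero[OF f(2)] that sub by auto
  qed (use \<open>0 < x\<close> in auto)
  then have "(\<lambda>N. Re (of_real ((-1) ^ m * fact m * ?s N))) \<longlonglongrightarrow> Re ((deriv ^^ m) (l f) (of_real x))"
    unfolding P_deriv by (rule tendsto_Re)
  then have "(\<lambda>N. (-1) ^ m / fact m * ((-1) ^ m * fact m * ?s N)) \<longlonglongrightarrow>
      (-1) ^ m / fact m * Re ((deriv ^^ m) (l f) (of_real x))"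
    unfolding Re_complex_of_real by (rule tendsto_mult_left)
  moreover have "(-1) ^ m / fact m * ((-1) ^ m * fact m * s) = s" for s :: real
    by (cases "even m") simp_all
  moreover have "?s N = (\<Sum>k<N + r. if k \<in> J then 1 / ((a - c k)\<^sup>2 + x) ^ (m + 1) else 0)" for N
    by (subst sum.inter_filter[symmetric]) (auto intro!: sum.cong)
  ultimately have "(\<lambda>N. \<Sum>k<N + r. if k \<in> J then 1 / ((a - c k)\<^sup>2 + x) ^ (m + 1) else 0)
      \<longlonglongrightarrow> (-1) ^ m / fact m * Re ((deriv ^^ m) (l f) (of_real x))"
    by simp
  then show ?thesis
    unfolding sums_def l_def by (rule LIMSEQ_offset)
qed

text \<open>Schwarz reflection: $\overline{f(\overline{z})}$ is entire and agrees with \<open>f\<close> on the real axis.\<close>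

lemma real_entire_cnj:
  assumes "real_entire f"
  shows "f (cnj z) = cnj (f z)"
proof -
  have holo: "f holomorphic_on UNIV" and real: "\<And>x::real. f (of_real x) \<in> \<real>"
    using assms by (auto simp: real_entire_def)
  have "(cnj \<circ> f \<circ> cnj) z - f z = 0"
  proof (rule analytic_continuation[of "\<lambda>z. (cnj \<circ> f \<circ> cnj) z - f z" UNIV \<real> 0])
    show "(\<lambda>z. (cnj \<circ> f \<circ> cnj) z - f z) holomorphic_on UNIV"
      by (intro holomorphic_intros holomorphic_on_compose_cnj_cnj holo
          holomorphic_on_subset[OF holo]) auto
    show "(0::complex) islimpt \<real>"
      unfolding islimpt_approachable
    proof (intro allI impI)
      fix e :: real assume "0 < e"
      then show "\<exists>x'\<in>\<real>. x' \<noteq> (0::complex) \<and> dist x' 0 < e"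
        by (intro bexI[of _ "of_real (e / 2)"]) auto
    qed
    show "(cnj \<circ> f \<circ> cnj) w - f w = 0" if w: "w \<in> \<real>" for w
    proof -
      obtain y where "w = of_real y"
        using w by (elim Reals_cases)
      then show ?thesis
        using real[of y] by (simp add: Reals_cnj_iff)
    qed
  qed auto
  then show ?thesis
    by (metis complex_cnj_cnj comp_apply eq_iff_diff_eq_0)
qed

text \<open>$V(x)$ is the product of $f(a + i\sqrt{x})$ with its conjugate, and $f$ has
  no zeros off the real axis; hence it is positive, so that the principal branch of the logarithm is holomorphic near it.\<close>

lemma ln_cmod_on_vertical_line:
  fixes a x :: real
  assumes f: "real_entire f" "\<And>z. f z = 0 \<Longrightarrow> z \<in> \<real>" and "0 < x"
  shows "line_square f a (of_real x) \<notin> \<real>\<^sub>\<le>\<^sub>0"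
    and "ln (cmod (f (of_real a + \<i> * of_real (sqrt x)))) = Re (Ln (line_square f a (of_real x))) / 2"
proof -
  let ?u = "of_real a + \<i> * of_real (sqrt x)"
  have "cnj ?u = of_real a - \<i> * of_real (sqrt x)"
    by simp
  then have V: "line_square f a (of_real x) = of_real ((cmod (f ?u))\<^sup>2)"
    using \<open>0 < x\<close> real_entire_cnj[OF f(1), of ?u]
    by (simp add: line_square_def of_real_sqrt[symmetric] complex_norm_square del: of_real_power)
  have "?u \<notin> \<real>"
    using \<open>0 < x\<close> by (simp add: complex_is_Real_iff)
  with f(2) have pos: "0 < cmod (f ?u)"
    by auto
  then show "line_square f a (of_real x) \<notin> \<real>\<^sub>\<le>\<^sub>0"
    unfolding V by (simp del: of_real_power)
  show "ln (cmod (f ?u)) = Re (Ln (line_square f a (of_real x))) / 2"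
    unfolding V using pos by (subst Ln_of_real) (auto simp: ln_realpow)
qed

lemma higher_deriv_ln_cmod_on_vertical_line:
  fixes f :: "complex \<Rightarrow> complex" and a x :: real
  defines "F \<equiv> (\<lambda>y::real. ln (cmod (f (of_real a + \<i> * of_real (sqrt y)))))"
  assumes f: "real_entire f" "\<And>z. f z = 0 \<Longrightarrow> z \<in> \<real>" and "0 < x"
  shows "(deriv ^^ j) F field_differentiable at x"
    and "(deriv ^^ Suc j) F x =
      Re ((deriv ^^ j) (\<lambda>w. deriv (line_square f a) w / line_square f a w) (of_real x)) / 2"
proof -
  let ?V = "line_square f a" and ?S = "{w::complex. 0 < Re w}"
  define l where "l = (\<lambda>w. deriv ?V w / ?V w)"
  define D where "D = (\<lambda>j x. case j of 0 \<Rightarrow> F x | Suc i \<Rightarrow> Re ((deriv ^^ i) l (of_real x)) / 2)"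
  have V: "?V holomorphic_on ?S" "\<And>w. w \<in> ?S \<Longrightarrow> ?V w \<noteq> 0"
    using f(1) line_square_nonzero[OF f(2), where a = "of_real a"]
    by (auto intro!: holomorphic_line_square simp: real_entire_def)
  then have l: "l holomorphic_on ?S"
    unfolding l_def by (intro holomorphic_logderiv open_right_half_plane) auto
  have D: "(D j has_field_derivative D (Suc j) y) (at y)" if "y \<in> {0<..}" for j y
  proof (cases j)
    case 0
    have "((\<lambda>w. Ln (?V w)) has_field_derivative l (of_real y)) (at (of_real y))"
      using that ln_cmod_on_vertical_line(1)[OF f, of y a] unfolding l_def
      by (auto intro!: derivative_eq_intros holomorphic_derivI[OF V(1) open_right_half_plane]
          simp: field_simps)
    then have *: "((\<lambda>y. Re (Ln (?V (of_real y))) / 2) has_field_derivative Re (l (of_real y)) / 2) (at y)"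
      by (intro DERIV_cdivide has_field_derivative_Re has_vector_derivative_real_field)
    have "eventually (\<lambda>y. D 0 y = Re (Ln (?V (of_real y))) / 2) (nhds y)"
      using eventually_nhds_in_open[OF open_greaterThan that]
      by eventually_elim (simp add: D_def F_def ln_cmod_on_vertical_line(2)[OF f])
    with * show ?thesis
      unfolding 0 by (subst DERIV_cong_ev[OF refl _ refl]) (auto simp: D_def)
  next
    case (Suc i)
    have "((deriv ^^ i) l has_field_derivative (deriv ^^ Suc i) l (of_real y)) (at (of_real y))"
      using holomorphic_derivI[OF holomorphic_higher_deriv[OF l open_right_half_plane]
          open_right_half_plane, of "of_real y" i] that by simp
    then show ?thesis
      unfolding Suc D_def nat.case
      by (intro DERIV_cdivide has_field_derivative_Re has_vector_derivative_real_field)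
  qed
  show "(deriv ^^ j) F field_differentiable at x"
    using higher_deriv_has_field_derivative[of "{0<..}" F D x j] D \<open>0 < x\<close>
    by (auto simp: field_differentiable_def D_def)
  have "(deriv ^^ Suc j) F x = D (Suc j) x"
    using higher_deriv_eqI[of "{0<..}" F D x "Suc j"] D \<open>0 < x\<close> by (auto simp: D_def)
  then show "(deriv ^^ Suc j) F x = Re ((deriv ^^ j) (\<lambda>w. deriv ?V w / ?V w) (of_real x)) / 2"
    by (simp add: D_def l_def)
qed


section \<open>Partial products of the Hadamard representation\<close>

text \<open>The general term of the convergent series tends to 0, so that $|z/b_n| \le 1/2$ for all large \<open>n\<close>
  and all \<open>z\<close> in the disc, which is the range where $E_q(u) - 1 = O(u^{q+1})$. Padding terms
  $b_n = 0$ do no harm, as $z/0 = 0$ and $E_q(0) = 1$.\<close>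

lemma weierstrass_factor_bound_ev:
  assumes sm: "summable (\<lambda>n. 1 / cmod (b n) ^ (q + 1))" and "0 < R"
  shows "\<forall>\<^sub>F n in sequentially. \<forall>z\<in>cball 0 R.
    norm (weierstrass_factor q (z / b n) - 1) \<le> 3 * R ^ (q + 1) * (1 / cmod (b n) ^ (q + 1))"
proof -
  have "\<forall>\<^sub>F n in sequentially. 1 / cmod (b n) ^ (q + 1) < (1 / (2 * R)) ^ (q + 1)"
    by (rule order_tendstoD(2)[OF summable_LIMSEQ_zero[OF sm]]) (use \<open>0 < R\<close> in auto)
  then show ?thesis
  proof eventually_elim
    case (elim n)
    show ?case
    proof
      fix z :: complex assume z: "z \<in> cball 0 R"
      have "(1 / cmod (b n)) ^ (q + 1) < (1 / (2 * R)) ^ (q + 1)"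
        using elim by (simp add: power_one_over)
      then have b: "1 / cmod (b n) < 1 / (2 * R)"
        by (rule power_less_imp_less_base) (use \<open>0 < R\<close> in auto)
      have le: "norm (z / b n) \<le> R * (1 / cmod (b n))"
        using z by (auto simp: norm_divide intro!: divide_right_mono)
      also have "\<dots> \<le> R * (1 / (2 * R))"
        using b \<open>0 < R\<close> by (intro mult_left_mono) auto
      also have "\<dots> = 1 / 2"
        using \<open>0 < R\<close> by simp
      finally have "norm (weierstrass_factor q (z / b n) - 1) \<le> 3 * norm (z / b n) ^ Suc q"
        by (rule weierstrass_factor_bound)
      also have "\<dots> \<le> 3 * (R * (1 / cmod (b n))) ^ Suc q"
        by (intro mult_left_mono power_mono le) auto
      also have "\<dots> = 3 * R ^ (q + 1) * (1 / cmod (b n) ^ (q + 1))"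
        by (simp add: power_mult_distrib power_divide)
      finally show "norm (weierstrass_factor q (z / b n) - 1) \<le>
          3 * R ^ (q + 1) * (1 / cmod (b n) ^ (q + 1))" .
    qed
  qed
qed

lemma uniform_limit_weierstrass_product:
  assumes sm: "summable (\<lambda>n. 1 / cmod (b n) ^ (q + 1))" and "0 < R"
  shows "uniform_limit (cball 0 R) (\<lambda>N z. \<Prod>n<N. weierstrass_factor q (z / b n))
    (\<lambda>z. \<Prod>n. weierstrass_factor q (z / b n)) sequentially"
proof -
  let ?E = "\<lambda>n z. weierstrass_factor q (z / b n)"
  note bound = weierstrass_factor_bound_ev[OF sm \<open>0 < R\<close>]
  have sm': "summable (\<lambda>n. 3 * R ^ (q + 1) * (1 / cmod (b n) ^ (q + 1)))"
    by (rule summable_mult[OF sm])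
  have "uniformly_convergent_on (cball 0 R) (\<lambda>N z. \<Prod>n<N. ?E n z)"
  proof (rule uniformly_convergent_on_prod')
    show "uniformly_convergent_on (cball 0 R) (\<lambda>N z. \<Sum>n<N. norm (?E n z - 1))"
      by (rule Weierstrass_m_test'_ev[OF _ sm']) (use bound in simp)
    show "continuous_on (cball 0 R) (?E n)" for n
      unfolding divide_inverse by (intro continuous_intros)
  qed auto
  then obtain g where g: "uniform_limit (cball 0 R) (\<lambda>N z. \<Prod>n<N. ?E n z) g sequentially"
    by (auto simp: uniformly_convergent_on_def)
  have "g z = (\<Prod>n. ?E n z)" if z: "z \<in> cball 0 R" for z
  proof -
    have "abs_convergent_prod (\<lambda>n. ?E n z)"
      unfolding abs_convergent_prod_conv_summable
    proof (rule summable_comparison_test_ev[OF _ sm'])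
      show "\<forall>\<^sub>F n in sequentially. norm (norm (?E n z - 1)) \<le>
          3 * R ^ (q + 1) * (1 / cmod (b n) ^ (q + 1))"
        using bound by eventually_elim (use z in auto)
    qed
    then have "(\<lambda>N. \<Prod>n\<le>N. ?E n z) \<longlonglongrightarrow> (\<Prod>n. ?E n z)"
      by (intro convergent_prod_LIMSEQ abs_convergent_prod_imp_convergent_prod)
    moreover have "(\<lambda>N. \<Prod>n<N. ?E n z) \<longlonglongrightarrow> g z"
      using g z by (rule tendsto_uniform_limitI)
    then have "(\<lambda>N. \<Prod>n\<le>N. ?E n z) \<longlonglongrightarrow> g z"
      unfolding lessThan_Suc_atMost[symmetric] by (rule LIMSEQ_Suc)
    ultimately show ?thesis
      by (intro LIMSEQ_unique)
  qed
  with g show ?thesis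
    by (subst uniform_limit_cong'[symmetric]) auto
qed

lemma weierstrass_factor_poly_exp:
  assumes "\<beta> \<noteq> 0"
  obtains C G where "C \<noteq> 0" "degree G \<le> q"
    "\<And>z. weierstrass_factor q (z / \<beta>) = C * (z - \<beta>) * exp (poly G z)"
proof
  show "- 1 / \<beta> \<noteq> 0"
    using assms by simp
  show "degree (\<Sum>k=1..q. monom (1 / (\<beta> ^ k * of_nat k)) k) \<le> q"
    by (intro degree_sum_le) (auto intro: order.trans[OF degree_monom_le])
  show "weierstrass_factor q (z / \<beta>) =
      - 1 / \<beta> * (z - \<beta>) * exp (poly (\<Sum>k=1..q. monom (1 / (\<beta> ^ k * of_nat k)) k) z)" for z
    using assms
    by (simp add: weierstrass_factor_def poly_sum poly_monom power_divide field_simps)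
qed

text \<open>The indices below \<open>r\<close> carry the zero at the origin, the later ones the sequence \<open>b\<close> shifted by
  \<open>r\<close>; \<open>J\<close> leaves out the padding. In this way a single sequence of natural numbers lists all zeros
  with their multiplicities.\<close>

lemma hadamard_partial_product:
  fixes b :: "nat \<Rightarrow> complex" and r :: nat
  defines "J \<equiv> {k. k < r \<or> b (k - r) \<noteq> 0}" and "c \<equiv> (\<lambda>k. if k < r then 0 else b (k - r))"
  shows "\<exists>C G. C \<noteq> 0 \<and> degree G \<le> max (degree g) q \<and>
    (\<forall>z. z ^ r * exp (poly g z) * (\<Prod>n<N. weierstrass_factor q (z / b n)) =
      C * (\<Prod>k\<in>{k\<in>J. k < N + r}. z - c k) * exp (poly G z))"
proof (induction N)
  case 0
  have "{k\<in>J. k < 0 + r} = {..<r}"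
    by (auto simp: J_def)
  then have "z ^ r = (\<Prod>k\<in>{k\<in>J. k < 0 + r}. z - c k)" for z
    by (simp add: c_def)
  then show ?case
    by (intro exI[of _ 1] exI[of _ g]) simp
next
  case (Suc N)
  then obtain C G where CG: "C \<noteq> 0" "degree G \<le> max (degree g) q"
    "\<And>z. z ^ r * exp (poly g z) * (\<Prod>n<N. weierstrass_factor q (z / b n)) =
      C * (\<Prod>k\<in>{k\<in>J. k < N + r}. z - c k) * exp (poly G z)"
    by blast
  show ?case
  proof (cases "b N = 0")
    case True
    then have "{k\<in>J. k < Suc N + r} = {k\<in>J. k < N + r}"
      by (auto simp: J_def less_Suc_eq)
    with True CG show ?thesis
      by (intro exI[of _ C] exI[of _ G]) simp
  next
    case False
    then obtain D H where DH: "D \<noteq> 0" "degree H \<le> q"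
      "\<And>z. weierstrass_factor q (z / b N) = D * (z - b N) * exp (poly H z)"
      using weierstrass_factor_poly_exp by blast
    have "{k\<in>J. k < Suc N + r} = insert (N + r) {k\<in>J. k < N + r}"
      using False by (auto simp: J_def less_Suc_eq)
    then have new: "(\<Prod>k\<in>{k\<in>J. k < Suc N + r}. z - c k) =
        (z - b N) * (\<Prod>k\<in>{k\<in>J. k < N + r}. z - c k)" for z
      by (simp add: c_def)
    have "z ^ r * exp (poly g z) * (\<Prod>n<Suc N. weierstrass_factor q (z / b n)) =
        (C * D) * (\<Prod>k\<in>{k\<in>J. k < Suc N + r}. z - c k) * exp (poly (G + H) z)" for z
    proof -
      have "z ^ r * exp (poly g z) * (\<Prod>n<Suc N. weierstrass_factor q (z / b n)) =
          (z ^ r * exp (poly g z) * (\<Prod>n<N. weierstrass_factor q (z / b n)))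
            * weierstrass_factor q (z / b N)"
        by simp
      also have "\<dots> = (C * D) * (\<Prod>k\<in>{k\<in>J. k < Suc N + r}. z - c k) * exp (poly (G + H) z)"
        unfolding CG(3) DH(3) new by (simp add: exp_add)
      finally show ?thesis .
    qed
    moreover have "degree (G + H) \<le> max (degree g) q"
      using CG(2) DH(2) by (intro degree_add_le) auto
    ultimately show ?thesis
      using CG(1) DH(1) by (intro exI[of _ "C * D"] exI[of _ "G + H"]) auto
  qed
qed

text \<open>The degree bound \<open>p\<close> holds because the exponent of a partial product adds to \<open>g\<close> only polynomials
  of degree at most \<open>q\<close>. As the zeros are real, so is their enumeration \<open>c\<close>.\<close>

lemma finite_genus_real_zeros_approximation:
  assumes f: "real_entire f" "has_genus f p" "\<And>z. f z = 0 \<Longrightarrow> z \<in> \<real>"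
  obtains J :: "nat set" and c :: "nat \<Rightarrow> real" and P :: "nat \<Rightarrow> complex \<Rightarrow> complex" and r :: nat
  where "\<forall>l. finite {k\<in>J. c k = l} \<and> card {k\<in>J. c k = l} = zero_mult f (of_real l)"
    and "\<forall>R>0. uniform_limit (cball 0 R) P f sequentially"
    and "\<forall>N. \<exists>C G. C \<noteq> 0 \<and> degree G \<le> p \<and>
      (\<forall>z. P N z = C * (\<Prod>k\<in>{k\<in>J. k < N + r}. z - of_real (c k)) * exp (poly G z))"
proof -
  obtain b g q where b: "lists_nonzero_zeros f b"
    and sm: "summable (\<lambda>n. 1 / cmod (b n) ^ (q + 1))"
    and rep: "\<And>z. f z = z ^ zero_mult f 0 * exp (poly g z) * (\<Prod>n. weierstrass_factor q (z / b n))"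
    and p: "p = max (degree g) q"
    using f(2) unfolding has_genus_def by blast
  define r where "r = zero_mult f 0"
  define J where "J = {k. k < r \<or> b (k - r) \<noteq> 0}"
  define c where "c = (\<lambda>k. if k < r then 0 else b (k - r))"
  define P where "P = (\<lambda>N z. z ^ r * exp (poly g z) * (\<Prod>n<N. weierstrass_factor q (z / b n)))"
  have b_real: "b n \<in> \<real>" for n
  proof (cases "b n = 0")
    case False
    then have "finite {i. b i = b n}" "card {i. b i = b n} = zero_mult f (b n)"
      using b by (auto simp: lists_nonzero_zeros_def)
    moreover from this(1) have "card {i. b i = b n} \<noteq> 0"
      by (subst card_0_eq) auto
    ultimately show ?thesis
      using f(3) by (auto simp: zero_mult_def split: if_splits)
  qed simp
  then have c_real: "of_real (Re (c k)) = c k" for k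
    by (auto simp: c_def of_real_Re)
  have "finite {k\<in>J. Re (c k) = l} \<and> card {k\<in>J. Re (c k) = l} = zero_mult f (of_real l)" for l
  proof -
    have eq: "{k\<in>J. Re (c k) = l} = {k\<in>J. c k = of_real l}"
      by (metis Re_complex_of_real c_real)
    show ?thesis
    proof (cases "l = 0")
      case True
      then have "{k\<in>J. c k = of_real l} = {..<r}"
        by (auto simp: J_def c_def)
      with True show ?thesis
        unfolding eq by (simp add: r_def)
    next
      case False
      then have "{k\<in>J. c k = of_real l} = (\<lambda>n. n + r) ` {n. b n = of_real l}"
        by (auto simp: J_def c_def image_iff) (metis le_add_diff_inverse2 not_less)
      moreover have "finite {n. b n = of_real l}" "card {n. b n = of_real l} = zero_mult f (of_real l)"
        using b False by (auto simp: lists_nonzero_zeros_def)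
      ultimately show ?thesis
        unfolding eq by (simp add: card_image)
    qed
  qed
  moreover have "uniform_limit (cball 0 R) P f sequentially" if "0 < R" for R
  proof -
    let ?W = "\<lambda>z. \<Prod>n. weierstrass_factor q (z / b n)"
    note lim = uniform_limit_weierstrass_product[OF sm that]
    have "continuous_on (cball 0 R) ?W"
      by (rule uniform_limit_theorem[OF _ lim])
         (auto intro!: always_eventually continuous_intros simp: divide_inverse)
    then have "bounded (?W ` cball 0 R)"
      by (intro compact_imp_bounded compact_continuous_image) auto
    moreover have "bounded ((\<lambda>z. z ^ r * exp (poly g z)) ` cball 0 R)"
      by (intro compact_imp_bounded compact_continuous_image continuous_intros) auto
    ultimately have "uniform_limit (cball 0 R) P (\<lambda>z. z ^ r * exp (poly g z) * ?W z) sequentially"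
      unfolding P_def by (intro uniform_lim_mult lim uniform_limit_const)
    then show ?thesis
      unfolding r_def by (simp add: rep[symmetric])
  qed
  moreover have "\<exists>C G. C \<noteq> 0 \<and> degree G \<le> p \<and>
      (\<forall>z. P N z = C * (\<Prod>k\<in>{k\<in>J. k < N + r}. z - of_real (Re (c k))) * exp (poly G z))" for N
    using hadamard_partial_product[of g q r b N]
    by (simp add: c_real P_def p J_def) (simp add: c_def)
  ultimately show thesis
    by (intro that[of J "\<lambda>k. Re (c k)" P r] allI impI)
qed

section \<open>Integration against the zero measure\<close>

text \<open>Two ways to count with multiplicity, by repetition in a sequence and by pairs \<open>(l, j)\<close>, are matched
  fibre by fibre.\<close>

lemma bij_betw_multiplicity_index:
  assumes fibre: "\<And>l. finite {k\<in>J. c k = l} \<and> card {k\<in>J. c k = l} = \<nu> l"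
  obtains h where "bij_betw h {(l, j). j < \<nu> l} J" "\<And>l j. j < \<nu> l \<Longrightarrow> c (h (l, j)) = l"
proof -
  have "\<exists>e. bij_betw e {..<\<nu> l} {k\<in>J. c k = l}" for l
    using fibre[of l] ex_bij_betw_nat_finite[of "{k\<in>J. c k = l}"] by (auto simp: lessThan_atLeast0)
  then obtain e where e: "\<And>l. bij_betw (e l) {..<\<nu> l} {k\<in>J. c k = l}"
    by metis
  then have mem: "e l j \<in> J" "c (e l j) = l" if "j < \<nu> l" for l j
    using bij_betwE[OF e[of l]] that by auto
  have "bij_betw (\<lambda>(l, j). e l j) {(l, j). j < \<nu> l} J"
    unfolding bij_betw_def
  proof
    show "inj_on (\<lambda>(l, j). e l j) {(l, j). j < \<nu> l}"
    proof (rule inj_onI, clarify)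
      fix l j l' j' assume *: "j < \<nu> l" "j' < \<nu> l'" "e l j = e l' j'"
      then have "l = l'" using mem by metis
      with * show "l = l' \<and> j = j'"
        using bij_betw_imp_inj_on[OF e[of l]] by (auto dest: inj_onD)
    qed
    show "(\<lambda>(l, j). e l j) ` {(l, j). j < \<nu> l} = J"
    proof (intro equalityI subsetI)
      fix k assume "k \<in> J"
      then have "k \<in> e (c k) ` {..<\<nu> (c k)}"
        using bij_betw_imp_surj_on[OF e[of "c k"]] by auto
      then show "k \<in> (\<lambda>(l, j). e l j) ` {(l, j). j < \<nu> l}"
        by force
    qed (use mem in auto)
  qed
  then show thesis
    by (rule that) (use mem in auto)
qed

text \<open>The integral is a series over the zeros. For a nonnegative integrand the order of the zeros does
  not matter, so the series may be taken along the enumeration \<open>c\<close>, where its sum is known.\<close>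

lemma zero_measure_integral:
  fixes c :: "nat \<Rightarrow> real" and \<phi> :: "real \<Rightarrow> real"
  assumes fibre: "\<And>l. finite {k\<in>J. c k = l} \<and> card {k\<in>J. c k = l} = zero_mult f (of_real l)"
    and \<phi>: "\<phi> \<in> borel_measurable borel" "\<And>t. 0 \<le> t \<Longrightarrow> 0 \<le> \<phi> t"
    and sums: "(\<lambda>k. if k \<in> J then \<phi> ((a - c k)\<^sup>2) else 0) sums s"
  shows "set_integrable (zero_measure f a) {0..} \<phi> \<and>
    (LINT t:{0..}|zero_measure f a. \<phi> t) = s"
proof -
  obtain h where h: "bij_betw h (real_zeros f) J"
    and ch: "\<And>l j. (l, j) \<in> real_zeros f \<Longrightarrow> c (h (l, j)) = l"
    using bij_betw_multiplicity_index[OF fibre] by (auto simp: real_zeros_def)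
  let ?t = "\<lambda>k. indicator J k *\<^sub>R \<phi> ((a - c k)\<^sup>2)"
  let ?u = "\<lambda>i. \<phi> ((a - c (h i))\<^sup>2)"
  have t: "(\<lambda>k. if k \<in> J then \<phi> ((a - c k)\<^sup>2) else 0) = ?t"
    by (auto simp: indicator_def)
  have "norm (?t k) = ?t k" for k
    using \<phi>(2) by (simp add: indicator_def)
  then have int_t: "integrable (count_space UNIV) ?t"
    using sums unfolding t integrable_count_space_nat_iff by (simp add: sums_iff)
  have sum_t: "integral\<^sup>L (count_space UNIV) ?t = s"
    using sums_integral_count_space_nat[OF int_t] sums unfolding t by (rule sums_unique2)
  have J: "count_space J = restrict_space (count_space UNIV) J"
    by (simp add: restrict_count_space)
  have int_J: "integrable (count_space J) (\<lambda>k. \<phi> ((a - c k)\<^sup>2))"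
    unfolding J using int_t by (subst integrable_restrict_space) auto
  have sum_J: "integral\<^sup>L (count_space J) (\<lambda>k. \<phi> ((a - c k)\<^sup>2)) = s"
    unfolding J using sum_t by (subst integral_restrict_space) auto
  have h_meas: "h \<in> measurable (count_space (real_zeros f)) (count_space J)"
    using bij_betwE[OF h] by auto
  have int_u: "integrable (count_space (real_zeros f)) ?u"
    using int_J integrable_distr_eq[OF h_meas, of "\<lambda>k. \<phi> ((a - c k)\<^sup>2)"]
    by (simp add: distr_bij_count_space[OF h])
  have sum_u: "integral\<^sup>L (count_space (real_zeros f)) ?u = s"
    using sum_J integral_distr[OF h_meas, of "\<lambda>k. \<phi> ((a - c k)\<^sup>2)"]
    by (simp add: distr_bij_count_space[OF h])
  let ?c = "\<lambda>(l, j). (a - l)\<^sup>2"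
  let ?I = "\<lambda>t. indicator {0..} t *\<^sub>R \<phi> t"
  have cong: "?I (?c i) = ?u i" if "i \<in> real_zeros f" for i
    using that ch by (cases i) (auto simp: ch)
  have meas: "?c \<in> measurable (count_space (real_zeros f)) borel" "?I \<in> borel_measurable borel"
    using \<phi>(1) by auto
  have "integrable (zero_measure f a) ?I \<longleftrightarrow>
      integrable (count_space (real_zeros f)) (\<lambda>i. ?I (?c i))"
    unfolding zero_measure_def sum_point_masses_def by (rule integrable_distr_eq[OF meas])
  also have "\<dots> \<longleftrightarrow> integrable (count_space (real_zeros f)) ?u"
    by (rule Bochner_Integration.integrable_cong) (use cong in auto)
  finally have 1: "integrable (zero_measure f a) ?I"
    using int_u by simp
  have "integral\<^sup>L (zero_measure f a) ?I =
      integral\<^sup>L (count_space (real_zeros f)) (\<lambda>i. ?I (?c i))"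
    unfolding zero_measure_def sum_point_masses_def by (rule integral_distr[OF meas])
  also have "\<dots> = integral\<^sup>L (count_space (real_zeros f)) ?u"
    by (rule Bochner_Integration.integral_cong) (use cong in auto)
  finally have "integral\<^sup>L (zero_measure f a) ?I = s"
    using sum_u by simp
  with 1 show ?thesis
    by (simp add: set_integrable_def set_lebesgue_integral_def)
qed

section \<open>The representation formula\<close>

theorem corollary3p2:
  fixes f :: "complex \<Rightarrow> complex" and p m :: nat and a :: real
  defines "m \<equiv> p div 2"
  defines "F \<equiv> (\<lambda>y::real. ln (cmod (f (of_real a + \<i> * of_real (sqrt y)))))"
  assumes "real_entire f"
    and "has_genus f p"
    and "\<And>z. f z = 0 \<Longrightarrow> z \<in> \<real>"
  shows "\<forall>x>0.
           (\<forall>j\<le>m. ((deriv ^^ j) F) field_differentiable (at x)) \<and>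
           set_integrable (zero_measure f a) {0..} (\<lambda>t. 1 / (t + x) ^ (m + 1)) \<and>
           (-1) ^ m * (deriv ^^ (m + 1)) F x =
             fact m / 2 * (LINT t:{0..}|zero_measure f a. 1 / (t + x) ^ (m + 1))"
proof (intro allI impI)
  fix x :: real assume "0 < x"
  obtain J c P r where fibre: "\<forall>l. finite {k\<in>J. c k = l} \<and>
        card {k\<in>J. c k = l} = zero_mult f (of_real l)"
    and lim: "\<forall>R>0. uniform_limit (cball 0 R) P f sequentially"
    and P: "\<forall>N. \<exists>C G. C \<noteq> 0 \<and> degree G \<le> p \<and>
      (\<forall>z. P N z = C * (\<Prod>k\<in>{k\<in>J. k < N + r}. z - of_real (c k)) * exp (poly G z))"
    by (rule finite_genus_real_zeros_approximation[OF assms(3-5)])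
  have P': "\<exists>C G. C \<noteq> 0 \<and> degree G div 2 \<le> m \<and>
      (\<forall>z. P N z = C * (\<Prod>k\<in>{k\<in>J. k < N + r}. z - of_real (c k)) * exp (poly G z))" for N
    using P[rule_format, of N] unfolding m_def by (meson div_le_mono)
  have holo: "f holomorphic_on UNIV"
    using assms(3) by (simp add: real_entire_def)
  note deriv_F = higher_deriv_ln_cmod_on_vertical_line[OF assms(3,5) \<open>0 < x\<close>, where a = a, folded F_def]
  have "2 * (deriv ^^ (m + 1)) F x =
      Re ((deriv ^^ m) (\<lambda>w. deriv (line_square f a) w / line_square f a w) (of_real x))"
    using deriv_F(2)[of m] by simp
  then have "(\<lambda>k. if k \<in> J then 1 / ((a - c k)\<^sup>2 + x) ^ (m + 1) else 0) sums
      ((-1) ^ m / fact m * (2 * (deriv ^^ (m + 1)) F x))"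
    using sums_higher_deriv_logderiv_line_square[OF lim[rule_format] holo assms(5) P' \<open>0 < x\<close>,
        where a = a] by simp
  then have "set_integrable (zero_measure f a) {0..} (\<lambda>t. 1 / (t + x) ^ (m + 1)) \<and>
    (LINT t:{0..}|zero_measure f a. 1 / (t + x) ^ (m + 1)) =
      (-1) ^ m / fact m * (2 * (deriv ^^ (m + 1)) F x)"
    using \<open>0 < x\<close> by (intro zero_measure_integral[OF fibre[rule_format]]) auto
  with deriv_F(1) show "(\<forall>j\<le>m. ((deriv ^^ j) F) field_differentiable (at x)) \<and>
           set_integrable (zero_measure f a) {0..} (\<lambda>t. 1 / (t + x) ^ (m + 1)) \<and>
           (-1) ^ m * (deriv ^^ (m + 1)) F x =
             fact m / 2 * (LINT t:{0..}|zero_measure f a. 1 / (t + x) ^ (m + 1))"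
    by simp
qed

end
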